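(* Fix $p\in[0,1]$. For $n\ge1$ let $\mathcal G_n$ be the set of unlabelled simple undirected graphs on $n$ vertices, and let $p^\uparrow_n$ (from $\mathcal G_n$ to $\mathcal G_{n+1}$) and $p^\downarrow_{n+1}$ (from $\mathcal G_{n+1}$ to $\mathcal G_n$) be the up- and down-kernels on graphs defined in the context. Then for $n\ge2$, $$p^\uparrow_np^\downarrow_{n+1}=\frac{n-1}{n+1}\,p^\downarrow_np^\uparrow_{n-1}+\frac{2}{n+1}\,\delta_n,$$ where $\delta_n$ is the identity kernel on $\mathcal G_n$. Consequently, with $c_n=n(n+1)$, $T_n$ the transition operator on $C(\mathcal G_n)$ of $p^\uparrow_np^\downarrow_{n+1}$, $D_{n+1}:C(\mathcal G_n)\to C(\mathcal G_{n+1})$ the transition operator of $p^\downarrow_{n+1}$, and $A_n=c_n(T_n-I)$, the following hold for every $n\ge1$: $0<c_n<c_{n+1}$; $D_{n+1}$ is a transition operator from $C(\mathcal G_n)$ to $C(\mathcal G_{n+1})$; $\operatorname{range}(A_{n+1}+c_nI)\subset\operatorname{range}D_{n+1}$; $D_{n+1}$ is injective; and $A_{n+1}D_{n+1}=D_{n+1}A_n$.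
   Context: $p^\uparrow_n(G,G')$ is the probability of obtaining $G'$ from $G$ by choosing a uniformly random vertex of $G$, creating a copy of it with the same neighbourhood, and connecting the selected vertex and its copy with probability $1-p$ (not connecting them with probability $p$). $p^\downarrow_{n+1}(G',G)$ is the probability of obtaining $G$ from $G'$ by erasing a uniformly random vertex together with its incident edges. The transition operator of a stochastic matrix $\mu$ is $f\mapsto\sum_y\mu(\cdot,y)f(y)$. $C(\mathcal G_n)$ is the space of real functions on $\mathcal G_n$. *)

theory Defs
  imports "HOL-Probability.Probability_Mass_Function" "HOL-Library.FuncSet"
begin

section \<open>Unlabelled simple graphs\<close>

text \<open>
  A labelled graph is a pair of a finite vertex set and a set of two-element edges; natural numbers
  suffice as labels, since only isomorphism classes of finite graphs are considered in the end.
\<close>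

type_synonym lgraph = "nat set \<times> nat set set"

definition simple_graph :: "lgraph \<Rightarrow> bool" where
  "simple_graph G \<longleftrightarrow> finite (fst G) \<and> (\<forall>e\<in>snd G. e \<subseteq> fst G \<and> card e = 2)"

definition graph_isomorphism :: "lgraph \<Rightarrow> lgraph \<Rightarrow> (nat \<Rightarrow> nat) \<Rightarrow> bool" where
  "graph_isomorphism G H f \<longleftrightarrow> bij_betw f (fst G) (fst H) \<and>
     (\<forall>u\<in>fst G. \<forall>v\<in>fst G. {u, v} \<in> snd G \<longleftrightarrow> {f u, f v} \<in> snd H)"

definition isomorphic :: "lgraph \<Rightarrow> lgraph \<Rightarrow> bool" where
  "isomorphic G H \<longleftrightarrow> simple_graph G \<and> simple_graph H \<and> (\<exists>f. graph_isomorphism G H f)"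

lemma isomorphicI:
  "simple_graph G \<Longrightarrow> simple_graph H \<Longrightarrow> graph_isomorphism G H f \<Longrightarrow> isomorphic G H"
  by (auto simp: isomorphic_def)

lemma isomorphic_refl: "simple_graph G \<Longrightarrow> isomorphic G G"
  by (rule isomorphicI[where f = id]) (auto simp: graph_isomorphism_def)

lemma isomorphic_sym:
  assumes "isomorphic G H" shows "isomorphic H G"
proof -
  obtain f where f: "simple_graph G" "simple_graph H" "bij_betw f (fst G) (fst H)"
    "\<forall>u\<in>fst G. \<forall>v\<in>fst G. {u, v} \<in> snd G \<longleftrightarrow> {f u, f v} \<in> snd H"
    using assms by (auto simp: isomorphic_def graph_isomorphism_def)
  let ?g = "inv_into (fst G) f"
  have g: "bij_betw ?g (fst H) (fst G)" using f(3) by (rule bij_betw_inv_into)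
  have "?g u \<in> fst G \<and> f (?g u) = u" if "u \<in> fst H" for u
    using that g f(3) by (meson bij_betwE bij_betw_inv_into_right)
  then have "graph_isomorphism H G ?g" using f(4) g by (simp add: graph_isomorphism_def)
  then show ?thesis using f by (blast intro: isomorphicI)
qed

lemma isomorphic_trans:
  assumes "isomorphic G H" "isomorphic H K" shows "isomorphic G K"
proof -
  obtain f g where f: "graph_isomorphism G H f" and g: "graph_isomorphism H K g"
    using assms by (auto simp: isomorphic_def)
  have "f u \<in> fst H" if "u \<in> fst G" for u
    using f that by (auto simp: graph_isomorphism_def bij_betw_def)
  then have "graph_isomorphism G K (g \<circ> f)"
    using f g by (auto simp: graph_isomorphism_def intro: bij_betw_trans)
  then show ?thesis using assms by (auto simp: isomorphic_def)
qed

quotient_type ugraph = lgraph / partial: isomorphic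
proof (rule part_equivpI)
  show "\<exists>G. isomorphic G G"
    by (rule exI[of _ "({}, {})"], rule isomorphic_refl) (simp add: simple_graph_def)
  show "symp isomorphic" by (rule sympI) (rule isomorphic_sym)
  show "transp isomorphic" by (rule transpI) (rule isomorphic_trans)
qed

lemma abs_ugraph_eqI: "isomorphic G H \<Longrightarrow> abs_ugraph G = abs_ugraph H"
  by (rule Quotient3_rel_abs[OF Quotient3_ugraph])

lift_definition num_vertices :: "ugraph \<Rightarrow> nat" is "\<lambda>G. card (fst G)"
  by (auto simp: isomorphic_def graph_isomorphism_def intro: bij_betw_same_card)

definition unlabelled_graphs :: "nat \<Rightarrow> ugraph set" where
  "unlabelled_graphs n = {G. num_vertices G = n}"

lemma isomorphic_labels_less:
  assumes "simple_graph G"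
  shows "\<exists>H. isomorphic G H \<and> fst H = {..<card (fst G)}"
proof -
  have "finite (fst G)" using assms by (simp add: simple_graph_def)
  then obtain f where f: "bij_betw f (fst G) {..<card (fst G)}"
    by (metis atLeast0LessThan ex_bij_betw_finite_nat)
  define H where "H = ({..<card (fst G)}, (`) f ` snd G)"
  have "inj_on f (fst G)" using f by (simp add: bij_betw_def)
  have edge: "e \<subseteq> fst G" "card e = 2" if "e \<in> snd G" for e
    using that assms by (auto simp: simple_graph_def)
  have "simple_graph H"
    using edge f \<open>inj_on f (fst G)\<close>
    by (fastforce simp: simple_graph_def H_def bij_betw_def card_image inj_on_subset)
  moreover have "{u, v} \<in> snd G \<longleftrightarrow> {f u, f v} \<in> snd H" if "u \<in> fst G" "v \<in> fst G" for u v
  proof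
    assume "{f u, f v} \<in> snd H"
    then obtain e where e: "e \<in> snd G" "f ` {u, v} = f ` e" by (auto simp: H_def)
    then have "{u, v} = e"
      using inj_on_image_eq_iff[OF \<open>inj_on f (fst G)\<close>, of "{u, v}" e] edge(1) that by blast
    then show "{u, v} \<in> snd G" using e by simp
  qed (auto simp: H_def intro: rev_image_eqI)
  ultimately show ?thesis
    using assms f by (intro exI[of _ H] conjI isomorphicI[of _ _ f])
      (auto simp: graph_isomorphism_def H_def)
qed

lemma finite_unlabelled_graphs: "finite (unlabelled_graphs n)"
proof (rule finite_subset)
  show "unlabelled_graphs n \<subseteq> abs_ugraph ` ({{..<n}} \<times> Pow (Pow {..<n}))"
  proof
    fix U assume "U \<in> unlabelled_graphs n"
    then have n: "card (fst (rep_ugraph U)) = n"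
      by (simp add: unlabelled_graphs_def num_vertices.rep_eq)
    have "isomorphic (rep_ugraph U) (rep_ugraph U)"
      by (rule Quotient3_rep_reflp[OF Quotient3_ugraph])
    then obtain H where H: "isomorphic (rep_ugraph U) H" "fst H = {..<n}"
      using isomorphic_labels_less[of "rep_ugraph U"] n unfolding isomorphic_def by metis
    have "U = abs_ugraph H"
      using abs_ugraph_eqI[OF H(1)] Quotient3_abs_rep[OF Quotient3_ugraph] by metis
    moreover have "snd H \<subseteq> Pow (fst H)" using H(1) by (auto simp: isomorphic_def simple_graph_def)
    ultimately show "U \<in> abs_ugraph ` ({{..<n}} \<times> Pow (Pow {..<n}))"
      using H(2) by (auto intro!: image_eqI[of _ _ H] simp: mem_Times_iff)
  qed
qed simp


section \<open>The up- and down-kernels\<close>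

definition delete_vertex :: "lgraph \<Rightarrow> nat \<Rightarrow> lgraph" where
  "delete_vertex G v = (fst G - {v}, {e \<in> snd G. v \<notin> e})"

text \<open>The copy of \<open>v\<close> is labelled by an unused number \<open>w\<close>; it is joined to \<open>v\<close> iff \<open>b\<close> holds.\<close>

definition duplicate_vertex :: "lgraph \<Rightarrow> nat \<Rightarrow> bool \<Rightarrow> lgraph" where
  "duplicate_vertex G v b = (let w = (LEAST w. w \<notin> fst G) in
     (insert w (fst G),
      snd G \<union> {{w, u} | u. {v, u} \<in> snd G} \<union> (if b then {{v, w}} else {})))"

lemma fresh: "simple_graph G \<Longrightarrow> (LEAST w. w \<notin> fst G) \<notin> fst G"
  by (rule LeastI_ex) (simp add: simple_graph_def ex_new_if_finite)

lemma simple_graph_edgeD: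
  "simple_graph G \<Longrightarrow> {u, v} \<in> snd G \<Longrightarrow> u \<in> fst G \<and> v \<in> fst G \<and> u \<noteq> v"
  by (auto simp: simple_graph_def)

lemma simple_graph_delete: "simple_graph G \<Longrightarrow> simple_graph (delete_vertex G v)"
  by (auto simp: simple_graph_def delete_vertex_def)

lemma simple_graph_duplicate:
  assumes "simple_graph G" "v \<in> fst G" shows "simple_graph (duplicate_vertex G v b)"
proof -
  define w where "w = (LEAST w. w \<notin> fst G)"
  have w: "w \<notin> fst G" using fresh[OF assms(1)] by (simp add: w_def)
  have "u \<in> fst G" if "{v, u} \<in> snd G" for u using simple_graph_edgeD[OF assms(1) that] by simp
  then show ?thesis using assms w
    by (auto simp: simple_graph_def duplicate_vertex_def Let_def w_def[symmetric] card_insert_if)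
qed

lemma duplicate_edge_iff:
  assumes G: "simple_graph G" "v \<in> fst G" and w: "w = (LEAST w. w \<notin> fst G)"
  shows "{x, y} \<in> snd (duplicate_vertex G v b) \<longleftrightarrow>
    {x, y} \<in> snd G \<or> x = w \<and> {v, y} \<in> snd G \<or> y = w \<and> {v, x} \<in> snd G \<or>
    b \<and> (x = v \<and> y = w \<or> x = w \<and> y = v)"
  by (auto simp: duplicate_vertex_def Let_def w[symmetric] doubleton_eq_iff)

lemma isomorphic_delete:
  assumes "simple_graph G" "simple_graph H" "graph_isomorphism G H f" "v \<in> fst G"
  shows "isomorphic (delete_vertex G v) (delete_vertex H (f v))"
proof (rule isomorphicI[where f = f])
  have f: "bij_betw f (fst G) (fst H)" using assms(3) by (simp add: graph_isomorphism_def)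
  have "bij_betw f (fst G - {v}) (fst H - {f v})"
    using bij_betw_DiffI[OF f, of "{v}" "{f v}"] assms(4) f by (auto simp: bij_betw_def)
  moreover have "f u \<noteq> f v" "f v \<noteq> f u" if "u \<in> fst G" "u \<noteq> v" for u
    using f that assms(4) by (auto simp: bij_betw_def inj_on_def)
  ultimately show "graph_isomorphism (delete_vertex G v) (delete_vertex H (f v)) f"
    using assms(3) by (auto simp: graph_isomorphism_def delete_vertex_def)
qed (use assms simple_graph_delete in auto)

lemma isomorphic_duplicate:
  assumes "simple_graph G" "simple_graph H" "graph_isomorphism G H f" "v \<in> fst G"
  shows "isomorphic (duplicate_vertex G v b) (duplicate_vertex H (f v) b)"
proof -
  define w where "w = (LEAST w. w \<notin> fst G)"
  define w' where "w' = (LEAST w. w \<notin> fst H)"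
  define g where "g = f(w := w')"
  have w: "w \<notin> fst G" "w' \<notin> fst H"
    using fresh[OF assms(1)] fresh[OF assms(2)] by (simp_all add: w_def w'_def)
  have f: "bij_betw f (fst G) (fst H)"
    and E: "\<And>u v. u \<in> fst G \<Longrightarrow> v \<in> fst G \<Longrightarrow> {u, v} \<in> snd G \<longleftrightarrow> {f u, f v} \<in> snd H"
    using assms(3) by (simp_all add: graph_isomorphism_def)
  have fv: "f u \<in> fst H" if "u \<in> fst G" for u using f that by (auto simp: bij_betw_def)
  have inj: "f u = f u' \<longleftrightarrow> u = u'" if "u \<in> fst G" "u' \<in> fst G" for u u'
    using f that by (auto simp: bij_betw_def inj_on_def)
  have gf: "g u = f u" if "u \<in> fst G" for u using that w by (auto simp: g_def)
  have gw: "g w = w'" by (simp add: g_def)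
  have V: "fst (duplicate_vertex G v b) = insert w (fst G)"
    "fst (duplicate_vertex H (f v) b) = insert w' (fst H)"
    by (simp_all add: duplicate_vertex_def Let_def w_def w'_def)
  have "bij_betw g (fst G) (fst H)" using f gf by (simp cong: bij_betw_cong)
  then have "bij_betw g (insert w (fst G)) (insert w' (fst H))"
    using w gw notIn_Un_bij_betw[of w "fst G" g "fst H"] by simp
  moreover have "{x, y} \<in> snd (duplicate_vertex G v b) \<longleftrightarrow>
      {g x, g y} \<in> snd (duplicate_vertex H (f v) b)"
    if "x \<in> insert w (fst G)" "y \<in> insert w (fst G)" for x y
  proof -
    have nG: "{w} \<notin> snd G" "{w, u} \<notin> snd G" "{u, w} \<notin> snd G" for u
      using simple_graph_edgeD[OF assms(1), of w w] simple_graph_edgeD[OF assms(1), of w u]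
        simple_graph_edgeD[OF assms(1), of u w] w
      by auto
    have nH: "{w'} \<notin> snd H" "{w', u} \<notin> snd H" "{u, w'} \<notin> snd H" for u
      using simple_graph_edgeD[OF assms(2), of w' w'] simple_graph_edgeD[OF assms(2), of w' u]
        simple_graph_edgeD[OF assms(2), of u w'] w
      by auto
    have ne: "f u \<noteq> w'" "w' \<noteq> f u" "u \<noteq> w" "w \<noteq> u" if "u \<in> fst G" for u
      using fv[OF that] that w by auto
    show ?thesis
      unfolding duplicate_edge_iff[OF assms(1,4) w_def]
        duplicate_edge_iff[OF assms(2) fv[OF assms(4)] w'_def]
      using that assms(4) nG nH ne inj E gf gw by (elim insertE) simp_all
  qed
  ultimately have "graph_isomorphism (duplicate_vertex G v b) (duplicate_vertex H (f v) b) g"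
    by (simp add: graph_isomorphism_def V)
  then show ?thesis
    using assms fv by (intro isomorphicI simple_graph_duplicate) auto
qed

lemma bind_uniform_vertex_cong:
  assumes "isomorphic G H"
    and eq: "\<And>f v. graph_isomorphism G H f \<Longrightarrow> v \<in> fst G \<Longrightarrow> F G v = F H (f v)"
  shows "bind_pmf (pmf_of_set (fst G)) (F G) = bind_pmf (pmf_of_set (fst H)) (F H)"
proof (cases "fst G = {}")
  case True
  from assms(1) obtain f where
    *: "simple_graph G" "simple_graph H" "bij_betw f (fst G) (fst H)"
    by (auto simp: isomorphic_def graph_isomorphism_def)
  have "fst H = {}" using *(3) True by (auto simp: bij_betw_def)
  moreover have "snd K = {}" if "simple_graph K" "fst K = {}" for K
    using that by (fastforce simp: simple_graph_def)
  ultimately have "G = H" using * True by (simp add: prod_eq_iff)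
  then show ?thesis by simp
next
  case False
  from assms(1) obtain f where f: "graph_isomorphism G H f" and fin: "finite (fst G)"
    by (auto simp: isomorphic_def simple_graph_def)
  then have bij: "inj_on f (fst G)" "f ` fst G = fst H"
    by (auto simp: graph_isomorphism_def bij_betw_def)
  have "pmf_of_set (fst H) = map_pmf f (pmf_of_set (fst G))"
    using map_pmf_of_set_inj[OF bij(1) False fin] bij(2) by simp
  then show ?thesis
    using eq[OF f] set_pmf_of_set[OF False fin] by (simp add: bind_map_pmf cong: bind_pmf_cong_simp)
qed

text \<open>
  The random graphs obtained from a given graph. The lifting obligations are exactly the
  independence of the chosen labelling. The values at the graph without vertices are meaningless.
\<close>

lift_definition up_step :: "real \<Rightarrow> ugraph \<Rightarrow> ugraph pmf" is
  "\<lambda>p G. bind_pmf (pmf_of_set (fst G))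
     (\<lambda>v. map_pmf (\<lambda>b. abs_ugraph (duplicate_vertex G v b)) (bernoulli_pmf (1 - p)))"
  by (rule bind_uniform_vertex_cong, assumption)
    (auto simp: isomorphic_def intro!: map_pmf_cong abs_ugraph_eqI isomorphic_duplicate)

lift_definition down_step :: "ugraph \<Rightarrow> ugraph pmf" is
  "\<lambda>G. map_pmf (\<lambda>v. abs_ugraph (delete_vertex G v)) (pmf_of_set (fst G))"
  unfolding map_pmf_def
  by (rule bind_uniform_vertex_cong, assumption)
    (auto simp: isomorphic_def intro!: abs_ugraph_eqI isomorphic_delete)

definition up_kernel :: "real \<Rightarrow> ugraph \<Rightarrow> ugraph \<Rightarrow> real" where
  "up_kernel p G G' = pmf (up_step p G) G'"

definition down_kernel :: "ugraph \<Rightarrow> ugraph \<Rightarrow> real" where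
  "down_kernel G' G = pmf (down_step G') G"

definition id_kernel :: "'a \<Rightarrow> 'a \<Rightarrow> real" where
  "id_kernel x y = (if x = y then 1 else 0)"

definition kernel_comp :: "'b set \<Rightarrow> ('a \<Rightarrow> 'b \<Rightarrow> real) \<Rightarrow> ('b \<Rightarrow> 'c \<Rightarrow> real) \<Rightarrow> 'a \<Rightarrow> 'c \<Rightarrow> real"
  where "kernel_comp Y \<mu> \<nu> x z = (\<Sum>y\<in>Y. \<mu> x y * \<nu> y z)"


section \<open>Transition operators\<close>

text \<open>
  Real functions on a set \<open>X\<close> are represented by the extensional functions on \<open>X\<close>,
  so that two of them are equal iff they agree on \<open>X\<close>.
\<close>

abbreviation functions_on :: "'a set \<Rightarrow> ('a \<Rightarrow> real) set" where
  "functions_on X \<equiv> X \<rightarrow>\<^sub>E UNIV"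

definition stochastic_matrix :: "'a set \<Rightarrow> 'b set \<Rightarrow> ('a \<Rightarrow> 'b \<Rightarrow> real) \<Rightarrow> bool" where
  "stochastic_matrix X Y \<mu> \<longleftrightarrow>
     (\<forall>x\<in>X. (\<forall>y\<in>Y. 0 \<le> \<mu> x y) \<and> (\<Sum>y\<in>Y. \<mu> x y) = 1)"

definition transition_operator ::
    "'a set \<Rightarrow> 'b set \<Rightarrow> ('a \<Rightarrow> 'b \<Rightarrow> real) \<Rightarrow> ('b \<Rightarrow> real) \<Rightarrow> ('a \<Rightarrow> real)" where
  "transition_operator X Y \<mu> f = (\<lambda>x\<in>X. \<Sum>y\<in>Y. \<mu> x y * f y)"

definition is_transition_operator ::
    "'b set \<Rightarrow> 'a set \<Rightarrow> (('b \<Rightarrow> real) \<Rightarrow> ('a \<Rightarrow> real)) \<Rightarrow> bool" where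
  "is_transition_operator Y X L \<longleftrightarrow>
     (\<exists>\<mu>. stochastic_matrix X Y \<mu> \<and> (\<forall>f\<in>functions_on Y. L f = transition_operator X Y \<mu> f))"

abbreviation C\<^sub>\<G> :: "nat \<Rightarrow> (ugraph \<Rightarrow> real) set" where
  "C\<^sub>\<G> n \<equiv> functions_on (unlabelled_graphs n)"

definition rate :: "nat \<Rightarrow> real" where
  "rate n = real n * (real n + 1)"

definition T_op :: "real \<Rightarrow> nat \<Rightarrow> (ugraph \<Rightarrow> real) \<Rightarrow> (ugraph \<Rightarrow> real)" where
  "T_op p n = transition_operator (unlabelled_graphs n) (unlabelled_graphs n)
     (kernel_comp (unlabelled_graphs (n + 1)) (up_kernel p) down_kernel)"

text \<open>\<open>D_op n\<close> goes from functions on graphs with \<open>n - 1\<close> vertices to functions on graphs with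
  \<open>n\<close> vertices.\<close>

definition D_op :: "nat \<Rightarrow> (ugraph \<Rightarrow> real) \<Rightarrow> (ugraph \<Rightarrow> real)" where
  "D_op n = transition_operator (unlabelled_graphs n) (unlabelled_graphs (n - 1)) down_kernel"

definition A_op :: "real \<Rightarrow> nat \<Rightarrow> (ugraph \<Rightarrow> real) \<Rightarrow> (ugraph \<Rightarrow> real)" where
  "A_op p n f = (\<lambda>G\<in>unlabelled_graphs n. rate n * (T_op p n f G - f G))"

end

theory Submission
  imports Defs
begin

text \<open>
  In the up-then-down step on \<open>n\<close> vertices, the erased vertex is the selected vertex or its copy with
  probability \<open>2 / (n + 1)\<close>, which restores the graph; otherwise the selected and the erased vertex
  form a uniform ordered pair of distinct vertices, and erasing commutes with duplicating.
  With \<open>D\<close> and \<open>U\<close> the down- and up-operators this reads \<open>A\<^sub>n\<^sub>+\<^sub>1 = c\<^sub>n (D U - I)\<close>, while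
  \<open>A\<^sub>n = c\<^sub>n (U D - I)\<close>, whence the range and intertwining properties. Since \<open>D U\<close> and \<open>U D\<close> have the
  same nonzero eigenvalues, induction on \<open>n\<close> shows that \<open>T\<^sub>n = U D\<close> has no eigenvalue in
  \<open>(-\<infinity>, 0]\<close>; in particular \<open>D\<close> is injective.
\<close>

section \<open>Erasing vertices of a graph with a duplicated vertex\<close>

lemma fst_duplicate:
  "fst (duplicate_vertex G v b) = insert (LEAST w. w \<notin> fst G) (fst G)"
  by (simp add: duplicate_vertex_def Let_def)

lemma delete_edge_iff:
  "{x, y} \<in> snd (delete_vertex G v) \<longleftrightarrow> {x, y} \<in> snd G \<and> x \<noteq> v \<and> y \<noteq> v"
  by (auto simp: delete_vertex_def)

lemma fst_delete: "fst (delete_vertex G v) = fst G - {v}"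
  by (simp add: delete_vertex_def)

lemma isomorphic_relabel:
  assumes G: "simple_graph G" and H: "simple_graph H"
    and f: "bij_betw f (fst G) (fst H)"
    and "\<And>x y. x \<in> fst G \<Longrightarrow> y \<in> fst G \<Longrightarrow> {x, y} \<in> snd G \<longleftrightarrow> {f x, f y} \<in> snd H"
  shows "isomorphic G H"
  using assms by (intro isomorphicI[of G H f]) (auto simp: graph_isomorphism_def)

text \<open>Every edge added by the duplication contains the new label, so erasing that label undoes
  the duplication exactly and the identity is an isomorphism.\<close>

lemma isomorphic_delete_copy:
  assumes G: "simple_graph G" "v \<in> fst G"
  shows "isomorphic (delete_vertex (duplicate_vertex G v b) (LEAST w. w \<notin> fst G)) G"
proof -
  define w where "w = (LEAST w. w \<notin> fst G)"
  have w: "w \<notin> fst G" using fresh[OF G(1)] by (simp add: w_def)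
  show ?thesis
    unfolding w_def[symmetric]
  proof (rule isomorphic_relabel[where f = id])
    show "bij_betw id (fst (delete_vertex (duplicate_vertex G v b) w)) (fst G)"
      using w by (simp add: fst_delete fst_duplicate w_def[symmetric])
  next
    fix x y
    assume "x \<in> fst (delete_vertex (duplicate_vertex G v b) w)"
      "y \<in> fst (delete_vertex (duplicate_vertex G v b) w)"
    then show "{x, y} \<in> snd (delete_vertex (duplicate_vertex G v b) w) \<longleftrightarrow> {id x, id y} \<in> snd G"
      using w by (auto simp: delete_edge_iff duplicate_edge_iff[OF G w_def] fst_delete)
  qed (use G in \<open>auto intro: simple_graph_delete simple_graph_duplicate\<close>)
qed

text \<open>The copy has the same neighbours as \<open>v\<close> and takes over its place. The
  possible edge between the two disappears with \<open>v\<close>, so \<open>b\<close> does not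
  matter.\<close>

lemma isomorphic_delete_original:
  assumes G: "simple_graph G" "v \<in> fst G"
  shows "isomorphic (delete_vertex (duplicate_vertex G v b) v) G"
proof -
  define w where "w = (LEAST w. w \<notin> fst G)"
  have w: "w \<notin> fst G" using fresh[OF G(1)] by (simp add: w_def)
  define f where "f = id(w := v)"
  have fst: "fst (delete_vertex (duplicate_vertex G v b) v) = insert w (fst G - {v})"
    using w G by (auto simp: fst_delete fst_duplicate w_def[symmetric])
  \<comment> \<open>The isomorphism condition also covers x = y, where the pair collapses to a
    singleton; hence loops have to be excluded explicitly.\<close>
  have nG: "{w, u} \<notin> snd G" "{u, w} \<notin> snd G" "{w} \<notin> snd G" "{v} \<notin> snd G" for u
    using simple_graph_edgeD[OF G(1), of w u] simple_graph_edgeD[OF G(1), of u w]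
      simple_graph_edgeD[OF G(1), of w w] simple_graph_edgeD[OF G(1), of v v] w by auto
  show ?thesis
  proof (rule isomorphic_relabel[where f = f])
    show "bij_betw f (fst (delete_vertex (duplicate_vertex G v b) v)) (fst G)"
      unfolding fst using w G by (auto simp: f_def bij_betw_def inj_on_def)
  next
    fix x y
    assume "x \<in> fst (delete_vertex (duplicate_vertex G v b) v)"
      "y \<in> fst (delete_vertex (duplicate_vertex G v b) v)"
    moreover have "w \<noteq> v" using w G by auto
    ultimately show "{x, y} \<in> snd (delete_vertex (duplicate_vertex G v b) v) \<longleftrightarrow> {f x, f y} \<in> snd G"
      unfolding fst delete_edge_iff duplicate_edge_iff[OF G w_def]
      using w G nG by (elim insertE) (simp_all add: f_def insert_commute[of v x "{}"])
  qed (use G in \<open>auto intro: simple_graph_delete simple_graph_duplicate\<close>)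
qed

text \<open>Erasing a vertex other than \<open>v\<close> and its copy affects both alike: the copy
  of \<open>v\<close> loses its edge to \<open>u\<close> exactly when \<open>v\<close> does.\<close>

lemma isomorphic_delete_duplicate:
  assumes G: "simple_graph G" "v \<in> fst G" and u: "u \<in> fst G" "u \<noteq> v"
  shows "isomorphic (delete_vertex (duplicate_vertex G v b) u)
    (duplicate_vertex (delete_vertex G u) v b)"
proof -
  define w where "w = (LEAST w. w \<notin> fst G)"
  have w: "w \<notin> fst G" using fresh[OF G(1)] by (simp add: w_def)
  define K where "K = delete_vertex G u"
  have K: "simple_graph K" "v \<in> fst K"
    using G u by (auto simp: K_def fst_delete intro: simple_graph_delete)
  \<comment> \<open>Erasing \<open>u\<close> frees its label, so \<open>w'\<close> is the smaller of
    \<open>u\<close> and \<open>w\<close>. The two copies may thus carry different labels, and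
    \<open>f\<close> renames one to the other.\<close>
  define w' where "w' = (LEAST w. w \<notin> fst K)"
  have w': "w' \<notin> fst K" using fresh[OF K(1)] by (simp add: w'_def)
  have fstK: "fst K = fst G - {u}" by (simp add: K_def fst_delete)
  have sndK: "{x, y} \<in> snd K \<longleftrightarrow> {x, y} \<in> snd G \<and> x \<noteq> u \<and> y \<noteq> u" for x y
    by (simp add: K_def delete_edge_iff)
  define f where "f = id(w := w')"
  have fst: "fst (delete_vertex (duplicate_vertex G v b) u) = insert w (fst G - {u})"
    using w u by (auto simp: fst_delete fst_duplicate w_def[symmetric])
  have fst': "fst (duplicate_vertex K v b) = insert w' (fst G - {u})"
    by (auto simp: fstK[symmetric] fst_duplicate w'_def[symmetric])
  have nG: "{w, x} \<notin> snd G" "{x, w} \<notin> snd G" "{w} \<notin> snd G" for x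
    using simple_graph_edgeD[OF G(1), of w x] simple_graph_edgeD[OF G(1), of x w]
      simple_graph_edgeD[OF G(1), of w w] w by auto
  have nK: "{w', x} \<notin> snd K" "{x, w'} \<notin> snd K" "{w'} \<notin> snd K" for x
    using simple_graph_edgeD[OF K(1), of w' x] simple_graph_edgeD[OF K(1), of x w']
      simple_graph_edgeD[OF K(1), of w' w'] w' by auto
  show ?thesis
    unfolding K_def[symmetric]
  proof (rule isomorphic_relabel[where f = f])
    show "bij_betw f (fst (delete_vertex (duplicate_vertex G v b) u)) (fst (duplicate_vertex K v b))"
      unfolding fst fst' using w w' by (auto simp: fstK f_def bij_betw_def inj_on_def)
  next
    fix x y
    assume xy: "x \<in> fst (delete_vertex (duplicate_vertex G v b) u)"
      "y \<in> fst (delete_vertex (duplicate_vertex G v b) u)"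
    have f: "f w = w'" "\<And>x. x \<in> fst K \<Longrightarrow> f x = x"
      using w by (auto simp: f_def fstK)
    have ne: "x \<noteq> w" "w \<noteq> x" "x \<noteq> w'" "w' \<noteq> x" if "x \<in> fst K" for x
      using that w w' by (auto simp: fstK)
    have "w \<noteq> u" "v \<noteq> u" using w u by auto
    moreover have "{x, y} \<in> snd G \<longleftrightarrow> {x, y} \<in> snd K" if "x \<in> fst K" "y \<in> fst K" for x y
      using that by (auto simp: sndK fstK)
    moreover have "x \<noteq> u" if "x \<in> fst K" for x using that by (auto simp: fstK)
    moreover have "x = w \<or> x \<in> fst K" "y = w \<or> y \<in> fst K" using xy unfolding fst fstK by auto
    ultimately show "{x, y} \<in> snd (delete_vertex (duplicate_vertex G v b) u) \<longleftrightarrow>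
        {f x, f y} \<in> snd (duplicate_vertex K v b)"
      unfolding delete_edge_iff duplicate_edge_iff[OF G w_def] duplicate_edge_iff[OF K w'_def]
      using K nG nK ne f by (elim disjE) simp_all
  qed (use G K u in \<open>auto intro: simple_graph_delete simple_graph_duplicate simp: fst_duplicate\<close>)
qed


section \<open>Averages with respect to the kernels\<close>

lemma unlabelled_graph_labelling:
  assumes "U \<in> unlabelled_graphs n"
  obtains G where "simple_graph G" "card (fst G) = n" "U = abs_ugraph G"
proof
  have "isomorphic (rep_ugraph U) (rep_ugraph U)"
    by (rule Quotient3_rep_reflp[OF Quotient3_ugraph])
  then show "simple_graph (rep_ugraph U)" by (simp add: isomorphic_def)
  show "card (fst (rep_ugraph U)) = n"
    using assms by (simp add: unlabelled_graphs_def num_vertices.rep_eq)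
  show "U = abs_ugraph (rep_ugraph U)"
    using Quotient3_abs_rep[OF Quotient3_ugraph] by metis
qed

lemma abs_ugraph_in_unlabelled_graphs:
  assumes "simple_graph G" "card (fst G) = n"
  shows "abs_ugraph G \<in> unlabelled_graphs n"
  using assms num_vertices.abs_eq[OF isomorphic_refl[OF assms(1)]]
  by (simp add: unlabelled_graphs_def)

lemma abs_ugraph_delete_in:
  assumes "simple_graph G" "card (fst G) = Suc n" "v \<in> fst G"
  shows "abs_ugraph (delete_vertex G v) \<in> unlabelled_graphs n"
  using assms
  by (intro abs_ugraph_in_unlabelled_graphs simple_graph_delete)
    (auto simp: fst_delete card_Diff_singleton)

lemma card_duplicate:
  "simple_graph G \<Longrightarrow> card (fst (duplicate_vertex G v b)) = Suc (card (fst G))"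
  using fresh[of G] by (simp add: fst_duplicate simple_graph_def)

lemma abs_ugraph_duplicate_in:
  assumes "simple_graph G" "v \<in> fst G"
  shows "abs_ugraph (duplicate_vertex G v b) \<in> unlabelled_graphs (Suc (card (fst G)))"
  using assms
  by (intro abs_ugraph_in_unlabelled_graphs simple_graph_duplicate card_duplicate) auto

text \<open>Kernel compositions are finite sums over graphs, while the kernels come from random
  steps. As no mass lies outside \<open>Y\<close>, such sums are expectations and can be evaluated
  by the choice of a vertex.\<close>

lemma sum_pmf_mult_eq_expectation:
  fixes f :: "'a \<Rightarrow> real"
  assumes "finite Y" "set_pmf P \<subseteq> Y"
  shows "(\<Sum>y\<in>Y. pmf P y * f y) = measure_pmf.expectation P f"
  using assms by (subst integral_measure_pmf_real[of Y]) (auto simp: mult.commute)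

text \<open>Several vertices may lead to isomorphic graphs; averaging over the vertices of a
  labelled representative absorbs these multiplicities.\<close>

lemma sum_down_kernel:
  assumes G: "simple_graph G" "card (fst G) = Suc n"
  shows "(\<Sum>H\<in>unlabelled_graphs n. down_kernel (abs_ugraph G) H * f H) =
    (\<Sum>v\<in>fst G. f (abs_ugraph (delete_vertex G v))) / (real n + 1)"
proof -
  have fin: "finite (fst G)" "fst G \<noteq> {}" using G by (auto simp: simple_graph_def)
  have step: "down_step (abs_ugraph G) =
      map_pmf (\<lambda>v. abs_ugraph (delete_vertex G v)) (pmf_of_set (fst G))"
    by (rule down_step.abs_eq[OF isomorphic_refl[OF G(1)]])
  have "(\<Sum>H\<in>unlabelled_graphs n. down_kernel (abs_ugraph G) H * f H) =
      measure_pmf.expectation (down_step (abs_ugraph G)) f"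
    unfolding down_kernel_def using fin G abs_ugraph_delete_in[OF G]
    by (intro sum_pmf_mult_eq_expectation finite_unlabelled_graphs) (auto simp: step)
  also have "\<dots> = (\<Sum>v\<in>fst G. f (abs_ugraph (delete_vertex G v))) / (real n + 1)"
    using fin G by (simp add: step integral_pmf_of_set add.commute)
  finally show ?thesis .
qed

text \<open>The bounds on \<open>p\<close> give \<open>bernoulli_pmf (1 - p)\<close> its intended
  weights, and \<open>0 < n\<close> makes the uniform choice of a vertex meaningful.\<close>

lemma sum_up_kernel:
  assumes p: "0 \<le> p" "p \<le> 1" and G: "simple_graph G" "card (fst G) = n" "0 < n"
  shows "(\<Sum>H\<in>unlabelled_graphs (n + 1). up_kernel p (abs_ugraph G) H * f H) =
    (\<Sum>v\<in>fst G. (1 - p) * f (abs_ugraph (duplicate_vertex G v True)) +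
       p * f (abs_ugraph (duplicate_vertex G v False))) / real n"
proof -
  have fin: "finite (fst G)" "fst G \<noteq> {}" using G by (auto simp: simple_graph_def)
  have step: "up_step p (abs_ugraph G) = pmf_of_set (fst G) \<bind> (\<lambda>v.
      map_pmf (\<lambda>b. abs_ugraph (duplicate_vertex G v b)) (bernoulli_pmf (1 - p)))"
    by (rule up_step.abs_eq[OF isomorphic_refl[OF G(1)]])
  have sub: "set_pmf (up_step p (abs_ugraph G)) \<subseteq> unlabelled_graphs (n + 1)"
    using fin G abs_ugraph_duplicate_in[OF G(1)] by (auto simp: step)
  have "(\<Sum>H\<in>unlabelled_graphs (n + 1). up_kernel p (abs_ugraph G) H * f H) =
      measure_pmf.expectation (up_step p (abs_ugraph G)) f"
    unfolding up_kernel_def using sub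
    by (intro sum_pmf_mult_eq_expectation finite_unlabelled_graphs)
  also have "\<dots> = (\<Sum>v\<in>fst G. (1 - p) * f (abs_ugraph (duplicate_vertex G v True)) +
       p * f (abs_ugraph (duplicate_vertex G v False))) / real n"
    unfolding step using fin G p
    by (subst pmf_expectation_bind_pmf_of_set)
      (auto simp: sum_divide_distrib divide_inverse mult.commute sum_distrib_left)
  finally show ?thesis .
qed

lemma stochastic_down_kernel:
  "stochastic_matrix (unlabelled_graphs (Suc n)) (unlabelled_graphs n) down_kernel"
  unfolding stochastic_matrix_def
proof (intro ballI conjI)
  fix U assume "U \<in> unlabelled_graphs (Suc n)"
  then obtain G where "simple_graph G" "card (fst G) = Suc n" "U = abs_ugraph G"
    by (rule unlabelled_graph_labelling)
  then show "(\<Sum>H\<in>unlabelled_graphs n. down_kernel U H) = 1"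
    using sum_down_kernel[of G n "\<lambda>_. 1"] by (simp add: add.commute)
qed (simp add: down_kernel_def)


section \<open>The commutation relation\<close>

text \<open>The erased vertex is the copy, the original or another vertex. The first two cases
  restore \<open>G\<close>, which is the source of the 2 in the commutation relation.\<close>

lemma sum_delete_duplicate:
  fixes f :: "ugraph \<Rightarrow> real"
  assumes G: "simple_graph G" "v \<in> fst G"
  shows "(\<Sum>u\<in>fst (duplicate_vertex G v b). f (abs_ugraph (delete_vertex (duplicate_vertex G v b) u)))
    = (\<Sum>u\<in>fst G - {v}. f (abs_ugraph (duplicate_vertex (delete_vertex G u) v b)))
      + 2 * f (abs_ugraph G)"
proof -
  define w where "w = (LEAST w. w \<notin> fst G)"
  have w: "w \<notin> fst G" using fresh[OF G(1)] by (simp add: w_def)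
  have fin: "finite (fst G)" using G by (simp add: simple_graph_def)
  let ?F = "\<lambda>u. f (abs_ugraph (delete_vertex (duplicate_vertex G v b) u))"
  have "(\<Sum>u\<in>fst (duplicate_vertex G v b). ?F u) = ?F w + (?F v + (\<Sum>u\<in>fst G - {v}. ?F u))"
    unfolding fst_duplicate w_def[symmetric] using fin w G by (simp add: sum.remove)
  moreover have "?F w = f (abs_ugraph G)"
    using abs_ugraph_eqI[OF isomorphic_delete_copy[OF G, of b]] by (simp add: w_def)
  moreover have "?F v = f (abs_ugraph G)"
    using abs_ugraph_eqI[OF isomorphic_delete_original[OF G, of b]] by simp
  moreover have "(\<Sum>u\<in>fst G - {v}. ?F u) =
      (\<Sum>u\<in>fst G - {v}. f (abs_ugraph (duplicate_vertex (delete_vertex G u) v b)))"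
    using abs_ugraph_eqI[OF isomorphic_delete_duplicate[OF G, of _ b]] by (intro sum.cong) auto
  ultimately show ?thesis by simp
qed

text \<open>Up-down chooses the duplicated vertex first, down-up the erased one. Both sides are the
  full double sum minus its diagonal.\<close>

lemma sum_distinct_pairs_swap:
  fixes g :: "'a \<Rightarrow> 'a \<Rightarrow> real"
  assumes "finite V"
  shows "(\<Sum>v\<in>V. \<Sum>u\<in>V - {v}. g u v) = (\<Sum>u\<in>V. \<Sum>v\<in>V - {u}. g u v)"
  using assms by (simp add: sum_diff1 sum_subtractf sum.swap[of "\<lambda>v u. g u v" V V])

text \<open>Put n = m + 2. Both compositions contain the same sum \<open>Q\<close> over ordered
  pairs of distinct vertices, divided by n (n + 1) for up-down and by n (n - 1) for down-up, hence
  the factor (n - 1) / (n + 1). The remaining 2 n of the n (n + 1) choices in up-down restore the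
  graph.\<close>

lemma up_down_kernel:
  assumes p: "0 \<le> p" "p \<le> 1"
    and U: "U \<in> unlabelled_graphs (Suc (Suc m))" and H: "H \<in> unlabelled_graphs (Suc (Suc m))"
  shows "kernel_comp (unlabelled_graphs (Suc (Suc (Suc m)))) (up_kernel p) down_kernel U H =
    (real m + 1) / (real m + 3) *
      kernel_comp (unlabelled_graphs (Suc m)) down_kernel (up_kernel p) U H
    + 2 / (real m + 3) * id_kernel U H"
proof -
  obtain G where G: "simple_graph G" "card (fst G) = Suc (Suc m)" "U = abs_ugraph G"
    using U by (rule unlabelled_graph_labelling)
  have fin: "finite (fst G)" using G by (simp add: simple_graph_def)
  \<comment> \<open>Testing the averages against the indicator of \<open>H\<close> extracts single
    kernel entries.\<close>
  define \<delta> where "\<delta> X = (if X = H then 1 else 0 :: real)" for X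
  have sum_\<delta>: "(\<Sum>X\<in>unlabelled_graphs (Suc (Suc m)). g X * \<delta> X) = g H" for g
    using H by (simp add: \<delta>_def finite_unlabelled_graphs if_distrib cong: if_cong)
  define h where "h u v b = \<delta> (abs_ugraph (duplicate_vertex (delete_vertex G u) v b))" for u v b
  define k where "k u v = (1 - p) * h u v True + p * h u v False" for u v
  define Q where "Q = (\<Sum>v\<in>fst G. \<Sum>u\<in>fst G - {v}. k u v)"
  have down: "down_kernel (abs_ugraph (duplicate_vertex G v b)) H =
      ((\<Sum>u\<in>fst G - {v}. h u v b) + 2 * \<delta> U) / (real m + 3)" if "v \<in> fst G" for v b
    using sum_down_kernel[of "duplicate_vertex G v b" "Suc (Suc m)" \<delta>]
      sum_delete_duplicate[OF G(1) that, of \<delta> b] that G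
    by (simp add: sum_\<delta> card_duplicate simple_graph_duplicate h_def add.commute)
  have k: "(\<Sum>u\<in>V. k u v) = (1 - p) * (\<Sum>u\<in>V. h u v True) + p * (\<Sum>u\<in>V. h u v False)" for V v
    unfolding k_def by (simp only: sum.distrib sum_distrib_left)
  \<comment> \<open>The restoring term \<open>z\<close> is the same for both values of
    \<open>b\<close>, and the weights \<open>1 - p\<close> and \<open>p\<close> add up to one on
    it.\<close>
  have mix: "(1 - p) * ((x + z) / c) + p * ((y + z) / c) = ((1 - p) * x + p * y + z) / c" for x y z c
    by (cases "c = 0") (simp_all add: field_simps)
  have "kernel_comp (unlabelled_graphs (Suc (Suc (Suc m)))) (up_kernel p) down_kernel U H =
      (\<Sum>v\<in>fst G. (1 - p) * down_kernel (abs_ugraph (duplicate_vertex G v True)) H +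
        p * down_kernel (abs_ugraph (duplicate_vertex G v False)) H) / (real m + 2)"
    using sum_up_kernel[OF p G(1,2), of "\<lambda>X. down_kernel X H"]
    by (simp add: kernel_comp_def G(3) add.commute)
  also have "(\<Sum>v\<in>fst G. (1 - p) * down_kernel (abs_ugraph (duplicate_vertex G v True)) H +
        p * down_kernel (abs_ugraph (duplicate_vertex G v False)) H) =
      (\<Sum>v\<in>fst G. ((\<Sum>u\<in>fst G - {v}. k u v) + 2 * \<delta> U) / (real m + 3))"
    by (intro sum.cong refl) (simp only: down k mix)
  also have "\<dots> = (Q + 2 * (real m + 2) * \<delta> U) / (real m + 3)"
    using G(2) by (simp add: Q_def sum_divide_distrib[symmetric] sum.distrib)
  finally have 1: "kernel_comp (unlabelled_graphs (Suc (Suc (Suc m)))) (up_kernel p) down_kernel U H =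
      (Q + 2 * (real m + 2) * \<delta> U) / (real m + 3) / (real m + 2)" .
  have up: "up_kernel p (abs_ugraph (delete_vertex G u)) H =
      (\<Sum>v\<in>fst G - {u}. k u v) / (real m + 1)" if "u \<in> fst G" for u
    using sum_up_kernel[OF p, of "delete_vertex G u" "Suc m" \<delta>] that G fin
    by (simp add: sum_\<delta> simple_graph_delete fst_delete k_def h_def add.commute)
  have "kernel_comp (unlabelled_graphs (Suc m)) down_kernel (up_kernel p) U H =
      (\<Sum>u\<in>fst G. up_kernel p (abs_ugraph (delete_vertex G u)) H) / (real m + 2)"
    using sum_down_kernel[OF G(1,2), of "\<lambda>X. up_kernel p X H"]
    by (simp add: kernel_comp_def G(3) add.commute)
  also have "\<dots> = Q / (real m + 1) / (real m + 2)"
    using sum_distinct_pairs_swap[OF fin, of k]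
    by (simp add: Q_def up sum_divide_distrib[symmetric])
  finally have 2: "kernel_comp (unlabelled_graphs (Suc m)) down_kernel (up_kernel p) U H =
      Q / (real m + 1) / (real m + 2)" .
  \<comment> \<open>Stated for arbitrary reals, so that clearing denominators does not touch the sum
    inside \<open>Q\<close>.\<close>
  have "(a + 2 * c * d) / b / c = e / b * (a / e / c) + 2 / b * d"
    if "b > 0" "c > 0" "e > 0" for a b c d e :: real
    using that by (simp add: field_simps)
  from this[of "real m + 3" "real m + 2" "real m + 1" Q "\<delta> U"]
  have "(Q + 2 * (real m + 2) * \<delta> U) / (real m + 3) / (real m + 2) =
      (real m + 1) / (real m + 3) * (Q / (real m + 1) / (real m + 2)) + 2 / (real m + 3) * \<delta> U"
    by simp
  then show ?thesis unfolding 1 2 by (simp only: id_kernel_def \<delta>_def)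
qed


section \<open>The operators\<close>

abbreviation U_op :: "real \<Rightarrow> nat \<Rightarrow> (ugraph \<Rightarrow> real) \<Rightarrow> (ugraph \<Rightarrow> real)" where
  "U_op p n \<equiv> transition_operator (unlabelled_graphs n) (unlabelled_graphs (Suc n)) (up_kernel p)"

lemma transition_operator_kernel_comp:
  "transition_operator X Z (kernel_comp Y \<mu> \<nu>) f =
    transition_operator X Y \<mu> (transition_operator Y Z \<nu> f)"
proof -
  have "(\<Sum>z\<in>Z. kernel_comp Y \<mu> \<nu> x z * f z) = (\<Sum>y\<in>Y. \<mu> x y * (\<Sum>z\<in>Z. \<nu> y z * f z))" for x
    unfolding kernel_comp_def sum_distrib_left sum_distrib_right
    by (subst sum.swap) (simp add: mult.assoc)
  then show ?thesis by (auto simp: transition_operator_def)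
qed

text \<open>Agreement on \<open>Y\<close> suffices; this matters because eigenvalue equations are
  known only on graphs of one size.\<close>

lemma transition_operator_scale:
  "(\<And>y. y \<in> Y \<Longrightarrow> f y = c * g y) \<Longrightarrow> x \<in> X \<Longrightarrow>
    transition_operator X Y \<mu> f x = c * transition_operator X Y \<mu> g x"
  by (simp add: transition_operator_def sum_distrib_left mult.left_commute)

lemma transition_operator_diff:
  "x \<in> X \<Longrightarrow> transition_operator X Y \<mu> (\<lambda>y\<in>Y. c * (f y - g y)) x =
    c * (transition_operator X Y \<mu> f x - transition_operator X Y \<mu> g x)"
  by (simp add: transition_operator_def sum_distrib_left sum_subtractf[symmetric] algebra_simps)

lemma D_op_Suc:
  "D_op (Suc n) = transition_operator (unlabelled_graphs (Suc n)) (unlabelled_graphs n) down_kernel"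
  by (simp add: D_op_def)

lemma T_op_eq_U_op_D_op: "T_op p n f = U_op p n (D_op (Suc n) f)"
  by (simp add: T_op_def D_op_Suc transition_operator_kernel_comp)

text \<open>The kernel relation at N = n + 1 has the coefficients (N - 1) / (N + 1) and 2 / (N + 1).
  Kernels and operators compose in the same order, so down-then-up becomes D U.\<close>

lemma T_op_Suc:
  assumes p: "0 \<le> p" "p \<le> 1" and n: "1 \<le> n" and G: "G \<in> unlabelled_graphs (Suc n)"
  shows "T_op p (Suc n) f G =
    real n / (real n + 2) * D_op (Suc n) (U_op p n f) G + 2 / (real n + 2) * f G"
proof -
  obtain m where m: "n = Suc m" using n by (cases n) auto
  have "T_op p (Suc n) f G = (\<Sum>H\<in>unlabelled_graphs (Suc n).
      real n / (real n + 2) *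
        (kernel_comp (unlabelled_graphs n) down_kernel (up_kernel p) G H * f H)
      + 2 / (real n + 2) * (id_kernel G H * f H))"
    using G unfolding T_op_def transition_operator_def
    by (auto simp: m up_down_kernel[OF p] algebra_simps intro!: sum.cong)
  also have "\<dots> = real n / (real n + 2) *
      (\<Sum>H\<in>unlabelled_graphs (Suc n).
        kernel_comp (unlabelled_graphs n) down_kernel (up_kernel p) G H * f H)
      + 2 / (real n + 2) * (\<Sum>H\<in>unlabelled_graphs (Suc n). id_kernel G H * f H)"
    by (simp add: sum.distrib sum_distrib_left)
  also have "(\<Sum>H\<in>unlabelled_graphs (Suc n). id_kernel G H * f H) = f G"
    using G finite_unlabelled_graphs by (simp add: id_kernel_def if_distrib if_distribR cong: if_cong)
  also have "(\<Sum>H\<in>unlabelled_graphs (Suc n).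
        kernel_comp (unlabelled_graphs n) down_kernel (up_kernel p) G H * f H) =
      D_op (Suc n) (U_op p n f) G"
    using G fun_cong[OF transition_operator_kernel_comp[of "unlabelled_graphs (Suc n)"
        "unlabelled_graphs (Suc n)" "unlabelled_graphs n" down_kernel "up_kernel p" f], of G]
    by (simp add: D_op_Suc transition_operator_def)
  finally show ?thesis .
qed

text \<open>This explains the choice of the rates: c_{n+1} = (n + 1) (n + 2) gives c_{n+1} n / (n +
  2) = c_n and c_{n+1} (2 / (n + 2) - 1) = -c_n.\<close>

lemma A_op_Suc:
  assumes p: "0 \<le> p" "p \<le> 1" and n: "1 \<le> n" and G: "G \<in> unlabelled_graphs (Suc n)"
  shows "A_op p (Suc n) f G = rate n * (D_op (Suc n) (U_op p n f) G - f G)"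
proof -
  have clear: "c * (a / c * x + 2 / c * y - y) = a * x + 2 * y - c * y"
    if "c > 0" for a c x y :: real
    using that by (simp add: field_simps)
  have "rate (Suc n) = (real n + 1) * (real n + 2)" by (simp add: rate_def algebra_simps)
  then have "A_op p (Suc n) f G = (real n + 1) * ((real n + 2) *
      (real n / (real n + 2) * D_op (Suc n) (U_op p n f) G + 2 / (real n + 2) * f G - f G))"
    using G by (simp add: A_op_def T_op_Suc[OF p n])
  also have "(real n + 2) *
      (real n / (real n + 2) * D_op (Suc n) (U_op p n f) G + 2 / (real n + 2) * f G - f G) =
      real n * (D_op (Suc n) (U_op p n f) G - f G)"
    by (subst clear) (simp_all add: algebra_simps)
  finally show ?thesis by (simp add: rate_def)
qed

section \<open>Nonpositive eigenvalues of the up-down operator and injectivity of the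
  down-operator\<close>

lemma unlabelled_graphs_1: "unlabelled_graphs 1 = {abs_ugraph ({0}, {})}"
proof -
  have pt: "simple_graph ({0}, {})" by (simp add: simple_graph_def)
  have "U = abs_ugraph ({0}, {})" if U: "U \<in> unlabelled_graphs 1" for U
  proof -
    obtain G where G: "simple_graph G" "card (fst G) = 1" "U = abs_ugraph G"
      using U by (rule unlabelled_graph_labelling)
    then obtain x where x: "fst G = {x}" by (auto simp: card_1_singleton_iff)
    have "{x} \<notin> snd G" using simple_graph_edgeD[OF G(1), of x x] by auto
    then have "isomorphic G ({0}, {})"
      using x by (intro isomorphic_relabel[OF G(1) pt, where f = "\<lambda>_. 0"])
        (auto simp: bij_betw_def)
    then show ?thesis unfolding G(3) by (rule abs_ugraph_eqI)
  qed
  moreover have "abs_ugraph ({0}, {}) \<in> unlabelled_graphs 1"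
    using abs_ugraph_in_unlabelled_graphs[OF pt] by simp
  ultimately show ?thesis by blast
qed

lemma T_op_1:
  assumes p: "0 \<le> p" "p \<le> 1" and G: "G \<in> unlabelled_graphs 1"
  shows "T_op p 1 f G = f G"
proof -
  obtain L where L: "simple_graph L" "card (fst L) = 1" "G = abs_ugraph L"
    using G by (rule unlabelled_graph_labelling)
  have 1: "unlabelled_graphs (Suc 0) = {G}" using G unlabelled_graphs_1 by auto
  \<comment> \<open>\<open>G\<close> is the only graph on one vertex, so the row sum 1 consists of
    this single entry.\<close>
  have *: "down_kernel H G = 1" if "H \<in> unlabelled_graphs (Suc 1)" for H
    using that stochastic_down_kernel[of 1] 1 by (simp add: stochastic_matrix_def)
  have "(\<Sum>H\<in>unlabelled_graphs (Suc 1). up_kernel p G H * down_kernel H G) = 1"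
    using sum_up_kernel[OF p L(1,2), of "\<lambda>_. 1", folded L(3)] L(2) by (simp add: *[simplified])
  then show ?thesis
    by (simp add: T_op_def transition_operator_def kernel_comp_def 1)
qed

text \<open>If T f = \<mu> f on n + 1 vertices, the commutation relation gives D U f = \<nu> f, so U
  D (U f) = \<nu> (U f) on n vertices. All \<mu> \<le> 0 are treated at once because the induction
  passes from \<mu> to a negative \<nu>.\<close>

lemma T_op_no_nonpos_eigenvalue:
  assumes p: "0 \<le> p" "p \<le> 1" and "1 \<le> n" and "\<mu> \<le> 0"
    and "\<And>G. G \<in> unlabelled_graphs n \<Longrightarrow> T_op p n f G = \<mu> * f G"
    and "G \<in> unlabelled_graphs n"
  shows "f G = 0"
  using assms(3-)
proof (induction n arbitrary: \<mu> f G rule: dec_induct)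
  case base
  then have "(1 - \<mu>) * f G = 0" using T_op_1[OF p] by (simp add: algebra_simps)
  then show ?case using base by simp
next
  case (step n)
  \<comment> \<open>The solution of \<mu> = (n \<nu> + 2) / (n + 2); the term -2 makes it negative
    even for \<mu> = 0.\<close>
  define \<nu> where "\<nu> = ((real n + 2) * \<mu> - 2) / real n"
  have n: "real n > 0" using step by simp
  have "(real n + 2) * \<mu> \<le> 0" using step.prems(1) by (intro mult_nonneg_nonpos) auto
  then have \<nu>: "\<nu> < 0" unfolding \<nu>_def using n by (intro divide_neg_pos) linarith+
  have DU: "D_op (Suc n) (U_op p n f) H = \<nu> * f H" if "H \<in> unlabelled_graphs (Suc n)" for H
  proof -
    have "\<nu> * y = x" if "a / c * x + 2 / c * y = \<mu> * y" "c > 0" "a > 0" "\<nu> = (c * \<mu> - 2) / a"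
      for a c x y :: real
    proof -
      have "a * x = (c * \<mu> - 2) * y" using that(1,2) by (simp add: field_simps)
      also have "c * \<mu> - 2 = a * \<nu>" using that(3,4) by simp
      finally show ?thesis using that(3) by simp
    qed
    from this[of "real n" "real n + 2"] show ?thesis
      using step.prems(2)[OF that] n by (simp add: T_op_Suc[OF p step.hyps(1) that] \<nu>_def)
  qed
  have U0: "U_op p n f K = 0" if "K \<in> unlabelled_graphs n" for K
  proof (rule step.IH[OF less_imp_le[OF \<nu>]])
    fix K assume "K \<in> unlabelled_graphs n"
    then show "T_op p n (U_op p n f) K = \<nu> * U_op p n f K"
      unfolding T_op_eq_U_op_D_op by (intro transition_operator_scale DU)
  qed (rule that)
  \<comment> \<open>Here \<nu> f = D (U f) = 0, since U f vanishes by induction.\<close>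
  have "\<nu> * f G = 0"
    using DU[OF step.prems(3)] U0 step.prems(3) by (simp add: D_op_Suc transition_operator_def)
  then show ?case using \<nu> by simp
qed

lemma inj_on_D_op:
  assumes n: "1 \<le> n"
  shows "inj_on (D_op (Suc n)) (C\<^sub>\<G> n)"
proof (rule inj_onI)
  fix f g assume fg: "f \<in> C\<^sub>\<G> n" "g \<in> C\<^sub>\<G> n" "D_op (Suc n) f = D_op (Suc n) g"
  \<comment> \<open>The factor 1 brings the difference into the form of
    \<open>transition_operator_diff\<close>.\<close>
  define h where "h = (\<lambda>G\<in>unlabelled_graphs n. 1 * (f G - g G))"
  have D: "D_op (Suc n) h G = 0" if "G \<in> unlabelled_graphs (Suc n)" for G
    unfolding h_def D_op_Suc transition_operator_diff[OF that]
    using fg(3) by (simp add: D_op_Suc)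
  have "f G = g G" if "G \<in> unlabelled_graphs n" for G
  proof -
    have "h G = 0"
    \<comment> \<open>D h = 0 gives U D h = 0 h, an equation with eigenvalue 0. As
      \<open>D_op\<close> does not involve \<open>p\<close>, the value 0 may be taken for
      it.\<close>
    proof (rule T_op_no_nonpos_eigenvalue[OF order_refl zero_le_one n order_refl])
      show "T_op 0 n h K = 0 * h K" if "K \<in> unlabelled_graphs n" for K
        using that by (simp add: T_op_eq_U_op_D_op transition_operator_def D)
    qed (simp_all add: that)
    then show ?thesis using that by (simp add: h_def)
  qed
  then show "f = g" using fg(1,2) by (blast intro: PiE_ext)
qed

theorem proposition7p1:
  fixes p :: real
  assumes "0 \<le> p" and "p \<le> 1"
  shows "(\<forall>n\<ge>2. \<forall>G\<in>unlabelled_graphs n. \<forall>H\<in>unlabelled_graphs n.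
            kernel_comp (unlabelled_graphs (n + 1)) (up_kernel p) down_kernel G H =
              (real n - 1) / (real n + 1)
                * kernel_comp (unlabelled_graphs (n - 1)) down_kernel (up_kernel p) G H
              + 2 / (real n + 1) * id_kernel G H) \<and>
         (\<forall>n\<ge>1.
            0 < rate n \<and> rate n < rate (n + 1) \<and>
            is_transition_operator (unlabelled_graphs n) (unlabelled_graphs (n + 1))
              (D_op (n + 1)) \<and>
            (\<lambda>f. \<lambda>G\<in>unlabelled_graphs (n + 1). A_op p (n + 1) f G + rate n * f G) ` C\<^sub>\<G> (n + 1)
              \<subseteq> D_op (n + 1) ` C\<^sub>\<G> n \<and>
            inj_on (D_op (n + 1)) (C\<^sub>\<G> n) \<and>
            (\<forall>f\<in>C\<^sub>\<G> n. A_op p (n + 1) (D_op (n + 1) f) = D_op (n + 1) (A_op p n f)))"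
proof (rule conjI; intro allI impI)
  fix n :: nat assume "2 \<le> n"
  then obtain m where "n = Suc (Suc m)" by (metis add_2_eq_Suc le_Suc_ex)
  then show "\<forall>G\<in>unlabelled_graphs n. \<forall>H\<in>unlabelled_graphs n.
      kernel_comp (unlabelled_graphs (n + 1)) (up_kernel p) down_kernel G H =
        (real n - 1) / (real n + 1)
          * kernel_comp (unlabelled_graphs (n - 1)) down_kernel (up_kernel p) G H
        + 2 / (real n + 1) * id_kernel G H"
    by (simp add: up_down_kernel[OF assms] add.commute)
next
  fix n :: nat assume n: "1 \<le> n"
  let ?D = "D_op (n + 1)"
  have rate: "0 < rate n" using n by (simp add: rate_def)
  have "rate n < rate (n + 1)" by (simp add: rate_def algebra_simps)
  moreover have "is_transition_operator (unlabelled_graphs n) (unlabelled_graphs (n + 1)) ?D"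
    unfolding is_transition_operator_def using stochastic_down_kernel[of n]
    by (auto simp: D_op_Suc intro!: exI[of _ down_kernel])
  moreover have "(\<lambda>G\<in>unlabelled_graphs (n + 1). A_op p (n + 1) f G + rate n * f G) \<in> ?D ` C\<^sub>\<G> n" for f
  proof
    \<comment> \<open>The preimage is c_n U f, because \<open>A_op_Suc\<close> says that A_{n+1} +
      c_n I = c_n D U.\<close>
    let ?g = "\<lambda>K\<in>unlabelled_graphs n. rate n * U_op p n f K"
    show "?g \<in> C\<^sub>\<G> n" by simp
    have "?D ?g G = rate n * ?D (U_op p n f) G" if "G \<in> unlabelled_graphs (n + 1)" for G
      using that by (auto simp: D_op_Suc intro!: transition_operator_scale)
    then show "(\<lambda>G\<in>unlabelled_graphs (n + 1). A_op p (n + 1) f G + rate n * f G) = ?D ?g"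
      using A_op_Suc[OF assms n, of _ f]
      by (intro ext) (simp add: right_diff_distrib, simp add: D_op_Suc transition_operator_def)
  qed
  moreover have "inj_on ?D (C\<^sub>\<G> n)" using inj_on_D_op[OF n] by simp
  moreover have "A_op p (n + 1) (?D f) = ?D (A_op p n f)" if "f \<in> C\<^sub>\<G> n" for f
  proof
    fix G
    show "A_op p (n + 1) (?D f) G = ?D (A_op p n f) G"
    proof (cases "G \<in> unlabelled_graphs (Suc n)")
      case True
      then show ?thesis
        \<comment> \<open>Both sides are c_n (D U D f - D f): the left by \<open>A_op_Suc\<close>,
          the right by T_n = U D and linearity of D.\<close>
        using A_op_Suc[OF assms n True, of "?D f"]
        unfolding A_op_def[of p n] T_op_eq_U_op_D_op Suc_eq_plus1[symmetric] D_op_Suc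
          transition_operator_diff[OF True]
        by simp
    next
      case False
      \<comment> \<open>Off the set of graphs both restricted functions take the value
        \<open>undefined\<close>.\<close>
      then show ?thesis by (simp add: A_op_def D_op_Suc transition_operator_def)
    qed
  qed
  ultimately show "0 < rate n \<and> rate n < rate (n + 1) \<and>
      is_transition_operator (unlabelled_graphs n) (unlabelled_graphs (n + 1)) ?D \<and>
      (\<lambda>f. \<lambda>G\<in>unlabelled_graphs (n + 1). A_op p (n + 1) f G + rate n * f G) ` C\<^sub>\<G> (n + 1)
        \<subseteq> ?D ` C\<^sub>\<G> n \<and>
      inj_on ?D (C\<^sub>\<G> n) \<and>
      (\<forall>f\<in>C\<^sub>\<G> n. A_op p (n + 1) (?D f) = ?D (A_op p n f))"
    using rate by blast
qed

end
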